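(* Let $Q=(Q_n)_{n=0}^\infty$ be a generalized approximation scheme on a Banach space $X$. Define $Q_\infty=\overline{\bigcup_{n=0}^\infty Q_n}$ (norm closure). Then the family $\mathcal{N}_Q=\{Q_n\}_{n=0}^\infty\cup\{Q_\infty\}\cup\{X\}$ is a complete nest of closed subspaces of $X$.
   Context: A generalized approximation scheme on $X$ is a sequence $Q=(Q_n)_{n=0}^\infty$ of closed linear subspaces of $X$ such that: (GA1) $\{0\}=Q_0\subset Q_1\subset\dots\subset Q_n\subset\dots\subset X$ (inclusions not necessarily strict); (GA2) $\lambda Q_n\subset Q_n$ for all $n$ and all scalars $\lambda$; (GA3) $Q_n+Q_m\subseteq Q_{n+m}$ for all $n,m$. A nest of closed subspaces of $X$ is a family of closed linear subspaces totally ordered by inclusion. A nest is complete if it contains $\{0\}$ and $X$, is closed under arbitrary intersections, and is closed under (norm) closures of arbitrary unions; that is, for every subfamily $\mathcal{N}'$ of the nest (non-empty, the empty case being covered by the usual conventions), $\bigcap_{Y\in\mathcal{N}'}Y$ and $\overline{\bigcup_{Y\in\mathcal{N}'}Y}$ belong to the nest. *)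

theory Defs
  imports "HOL-Analysis.Analysis"
begin

(* The class banach only provides real scalars. This locale adds the actual scalar field, so that
   real (scale = scaleR) and complex Banach spaces are both covered. *)
locale banach_space_over = vector_space scale
  for scale :: "'k::real_normed_field \<Rightarrow> 'a::banach \<Rightarrow> 'a" +
  assumes scale_of_real: "scale (of_real r) x = r *\<^sub>R x"
    and norm_scale: "norm (scale c x) = norm c * norm x"
begin

definition closed_subspace :: "'a set \<Rightarrow> bool" where
  "closed_subspace Y \<longleftrightarrow> subspace Y \<and> closed Y"

(* The sum of sets is the Minkowski sum. *)
definition generalized_approximation_scheme :: "(nat \<Rightarrow> 'a set) \<Rightarrow> bool" where
  "generalized_approximation_scheme Q \<longleftrightarrow>
     (\<forall>n. closed_subspace (Q n)) \<and>
     Q 0 = {0} \<and> (\<forall>n. Q n \<subseteq> Q (Suc n)) \<and>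
     (\<forall>n c. scale c ` Q n \<subseteq> Q n) \<and>
     (\<forall>n m. Q n + Q m \<subseteq> Q (n + m))"

definition nest :: "'a set set \<Rightarrow> bool" where
  "nest N \<longleftrightarrow> (\<forall>Y\<in>N. closed_subspace Y) \<and> chain\<^sub>\<subseteq> N"

(* For the empty subfamily, the intersection is the whole space and the closed union is read as
   {0}; the first two membership conditions cover it. *)
definition complete_nest :: "'a set set \<Rightarrow> bool" where
  "complete_nest N \<longleftrightarrow>
     nest N \<and> {0} \<in> N \<and> UNIV \<in> N \<and>
     (\<forall>M. M \<subseteq> N \<and> M \<noteq> {} \<longrightarrow> \<Inter>M \<in> N \<and> closure (\<Union>M) \<in> N)"

end

definition Q_infinity :: "(nat \<Rightarrow> 'a::topological_space set) \<Rightarrow> 'a set" where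
  "Q_infinity Q = closure (\<Union>n. Q n)"

definition nest_of_scheme :: "(nat \<Rightarrow> 'a::topological_space set) \<Rightarrow> 'a set set" where
  "nest_of_scheme Q = range Q \<union> {Q_infinity Q} \<union> {UNIV}"

end

(* The family is well-ordered by inclusion, so a non-empty intersection is attained at its least
   member. A union of the Q_n either has a greatest member or is cofinal in the sequence, in which
   case it has closure Q_infinity. *)
theory Submission
  imports Defs
begin

context banach_space_over
begin

text \<open>By \<open>scale_of_real\<close>, real scaling is a special case of \<open>scale\<close>,
  so \<open>scale c\<close> commutes with it. It is therefore a real-linear map, and
  \<open>norm_scale\<close> makes it bounded by \<open>norm c\<close>.\<close>

lemma continuous_on_scale: "continuous_on S (scale c)"
proof (rule continuous_on_subset)
  have "bounded_linear (scale c)"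
  proof (rule bounded_linear_intro[where K = "norm c"])
    show "scale c (r *\<^sub>R x) = r *\<^sub>R scale c x" for r x
      unfolding scale_of_real[symmetric] by (rule scale_left_commute)
  qed (auto simp: scale_right_distrib norm_scale mult.commute)
  then show "continuous_on UNIV (scale c)"
    by (rule linear_continuous_on)
qed simp

text \<open>Here \<open>subspace\<close> refers to the scalar field \<open>'k\<close>, not only to
  the reals. Addition and each \<open>scale c\<close> are continuous, so both pass to
  limits.\<close>

lemma subspace_closure:
  assumes "subspace Y"
  shows "subspace (closure Y)"
proof (rule subspaceI)
  show "0 \<in> closure Y"
    using subspace_0[OF assms] closure_subset by blast
  show "x + y \<in> closure Y" if "x \<in> closure Y" "y \<in> closure Y" for x y
  proof -
    have "Y + Y \<subseteq> Y"
      using subspace_add[OF assms] by (auto elim: set_plus_elim)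
    then have "closure Y + closure Y \<subseteq> closure Y"
      using closure_sum[of Y Y] closure_mono by blast
    then show ?thesis
      using that by blast
  qed
  show "scale c x \<in> closure Y" if "x \<in> closure Y" for c x
  proof -
    have "scale c ` closure Y \<subseteq> closure Y"
    proof (rule image_closure_subset[OF continuous_on_scale closed_closure])
      show "scale c ` Y \<subseteq> closure Y"
        using subspace_scale[OF assms] closure_subset by blast
    qed
    then show ?thesis
      using that by blast
  qed
qed

text \<open>Monotonicity puts any two vectors of the union into one common
  \<open>Q (max m n)\<close>, where they can be added.\<close>

lemma subspace_Union_incseq:
  assumes "\<And>n. subspace (Q n)" "incseq Q"
  shows "subspace (\<Union>n. Q n)"
proof (rule subspaceI)
  show "0 \<in> (\<Union>n. Q n)"
    using subspace_0[OF assms(1)] by blast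
  show "scale c x \<in> (\<Union>n. Q n)" if "x \<in> (\<Union>n. Q n)" for c x
    using that subspace_scale[OF assms(1)] by blast
  show "x + y \<in> (\<Union>n. Q n)" if xy: "x \<in> (\<Union>n. Q n)" "y \<in> (\<Union>n. Q n)" for x y
  proof -
    obtain m n where "x \<in> Q m" "y \<in> Q n"
      using xy by blast
    then have "x \<in> Q (max m n)" "y \<in> Q (max m n)"
      using incseqD[OF assms(2), of m "max m n"] incseqD[OF assms(2), of n "max m n"] by auto
    then show ?thesis
      using subspace_add[OF assms(1)] by blast
  qed
qed

end

lemma subset_Q_infinity: "Q n \<subseteq> Q_infinity Q"
  unfolding Q_infinity_def by (rule subset_trans[OF UN_upper closure_subset]) simp

lemma chain_nest_of_scheme:
  assumes "incseq Q"
  shows "chain\<^sub>\<subseteq> (nest_of_scheme Q)"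
proof -
  have "Q m \<subseteq> Q n \<or> Q n \<subseteq> Q m" for m n
    using assms by (meson incseqD nat_le_linear)
  then show ?thesis
    using subset_Q_infinity[of Q] unfolding nest_of_scheme_def chain_subset_def by blast
qed

lemma Inter_mem_nest_of_scheme:
  assumes "incseq Q" "M \<subseteq> nest_of_scheme Q" "M \<noteq> {}"
  shows "\<Inter>M \<in> nest_of_scheme Q"
proof (cases "\<exists>n. Q n \<in> M")
  case True
  \<comment> \<open>The least index yields the least member: \<open>Q\<close> is increasing, and
    \<open>Q_infinity Q\<close> and \<open>UNIV\<close> contain every \<open>Q n\<close>.\<close>
  define k where "k = (LEAST n. Q n \<in> M)"
  have k: "Q k \<in> M"
    unfolding k_def using True by (rule LeastI_ex)
  have "Q k \<subseteq> Y" if Y: "Y \<in> M" for Y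
  proof -
    consider n where "Y = Q n" | "Y = Q_infinity Q" | "Y = UNIV"
      using assms(2) Y unfolding nest_of_scheme_def by blast
    then show ?thesis
    proof cases
      case 1
      then have "k \<le> n"
        unfolding k_def using Y by (auto intro: Least_le)
      then show ?thesis
        using 1 incseqD[OF assms(1)] by blast
    qed (use subset_Q_infinity in auto)
  qed
  then have "\<Inter>M = Q k"
    using k by blast
  then show ?thesis
    unfolding nest_of_scheme_def by blast
next
  case False
  \<comment> \<open>At most two sets are left, and the intersection is \<open>Q_infinity Q\<close>
    or \<open>UNIV\<close> according to whether the former occurs in \<open>M\<close>.\<close>
  then have "M \<subseteq> {Q_infinity Q, UNIV}"
    using assms(2) unfolding nest_of_scheme_def by blast
  then have "\<Inter>M \<in> {Q_infinity Q, UNIV}"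
    using assms(3) by (cases "Q_infinity Q \<in> M") auto
  then show ?thesis
    unfolding nest_of_scheme_def by blast
qed

lemma closure_Union_mem_nest_of_scheme:
  assumes "incseq Q" "\<And>n. closed (Q n)" "M \<subseteq> nest_of_scheme Q" "M \<noteq> {}"
  shows "closure (\<Union>M) \<in> nest_of_scheme Q"
\<comment> \<open>If \<open>M\<close> has a greatest member, that member is the union and is already
  closed, so the closure adds nothing.\<close>
proof (cases "\<exists>Y\<in>M. \<Union>M \<subseteq> Y")
  case True
  then obtain Y where Y: "Y \<in> M" "\<Union>M \<subseteq> Y"
    by blast
  then have "\<Union>M = Y"
    by blast
  moreover have "closed Y"
    using Y(1) assms(2,3) unfolding nest_of_scheme_def Q_infinity_def by auto
  ultimately show ?thesis
    using Y(1) assms(3) by auto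
next
  case False
  \<comment> \<open>\<open>UNIV\<close> would be a greatest member of \<open>M\<close>. Once it is
    excluded, so would \<open>Q_infinity Q\<close>.\<close>
  have below: "M \<subseteq> range Q"
  proof
    fix Y assume Y: "Y \<in> M"
    have "Y \<noteq> UNIV"
      using False Y by blast
    moreover have "Y \<noteq> Q_infinity Q"
    proof
      assume "Y = Q_infinity Q"
      moreover have "UNIV \<notin> M"
        using False by blast
      then have "\<Union>M \<subseteq> Q_infinity Q"
        using assms(3) subset_Q_infinity[of Q] unfolding nest_of_scheme_def by blast
      ultimately show False
        using False Y by blast
    qed
    ultimately show "Y \<in> range Q"
      using assms(3) Y unfolding nest_of_scheme_def by blast
  qed
  have cofinal: "Q n \<subseteq> \<Union>M" for n
  \<comment> \<open>If some \<open>Q n\<close> escaped the union, only indices below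
    \<open>n\<close> could occur in \<open>M\<close>, since every later \<open>Q i\<close> contains
    \<open>Q n\<close>. Then \<open>M\<close> would be a finite non-empty chain, which contains its
    own union and so has a greatest member.\<close>
  proof (rule ccontr)
    assume n: "\<not> Q n \<subseteq> \<Union>M"
    have "\<exists>i<n. Y = Q i" if Y: "Y \<in> M" for Y
    proof -
      obtain i where i: "Y = Q i"
        using below Y by blast
      have "\<not> n \<le> i"
        using n Y i incseqD[OF assms(1), of n i] by blast
      then show ?thesis
        using i not_le by blast
    qed
    then have "M \<subseteq> Q ` {..<n}"
      by blast
    then have "finite M"
      by (rule finite_surj[rotated]) simp
    moreover have "chain\<^sub>\<subseteq> M"
      using chain_nest_of_scheme[OF assms(1)] assms(3) unfolding chain_subset_def by blast
    ultimately have "\<Union>M \<in> M"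
      using assms(4) by (intro Union_in_chain[of M UNIV]) (auto simp: chain_subset_def subset_chain_def)
    then show False
      using False by blast
  qed
  have "\<Union>M = (\<Union>n. Q n)"
    using below cofinal by blast
  then show ?thesis
    unfolding nest_of_scheme_def Q_infinity_def by simp
qed

theorem lemma3p2:
  fixes scale :: "'k::real_normed_field \<Rightarrow> 'a::banach \<Rightarrow> 'a"
    and Q :: "nat \<Rightarrow> 'a set"
  assumes "banach_space_over scale"
    and "banach_space_over.generalized_approximation_scheme scale Q"
  shows "banach_space_over.complete_nest scale (nest_of_scheme Q)"
proof -
  interpret banach_space_over scale
    by (rule assms(1))
  have sub: "subspace (Q n)" and cl: "closed (Q n)" for n
    using assms(2) by (simp_all add: generalized_approximation_scheme_def closed_subspace_def)
  have zero: "Q 0 = {0}" and "\<And>n. Q n \<subseteq> Q (Suc n)"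
    using assms(2) by (simp_all add: generalized_approximation_scheme_def)
  then have inc: "incseq Q"
    by (intro incseq_SucI)
  \<comment> \<open>Only \<open>Q_infinity Q\<close> takes work: it is the closure of an increasing
    union of subspaces.\<close>
  have "closed_subspace Y" if "Y \<in> nest_of_scheme Q" for Y
    using that sub cl subspace_closure[OF subspace_Union_incseq[OF sub inc]]
    by (auto simp: nest_of_scheme_def Q_infinity_def closed_subspace_def)
  moreover have "{0} \<in> nest_of_scheme Q" "UNIV \<in> nest_of_scheme Q"
    using zero rangeI[of Q 0] by (auto simp: nest_of_scheme_def)
  ultimately show ?thesis
    unfolding complete_nest_def nest_def
    using chain_nest_of_scheme[OF inc] Inter_mem_nest_of_scheme[OF inc]
      closure_Union_mem_nest_of_scheme[OF inc cl] by blast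
qed

end
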